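(* Let $G$ be a finite graph (loops and multiple edges allowed) and let $H$ be an elementary contraction of $G$. Then $B'(G)-1\le B'(H)\le 2B'(G)-1$. Moreover, these bounds are sharp for each value of $B'(G)$: for each possible value $k$ of $B'(G)$, each of the two inequalities holds with equality for some $G$ with $B'(G)=k$ and some elementary contraction $H$ of $G$.
   Context: Contracting an edge $uv$ means deleting it and replacing $u$ and $v$ by a single vertex $w$ inheriting all other edge incidences of $u$ and $v$. An elementary contraction of $G$ is obtained by contracting one edge and keeping all other edges, even if loops or multiple edges arise. An edge-numbering of a multigraph $G$ is an assignment $f$ of distinct integers to the edges; $B'(f)$ is the maximum of $|f(e)-f(e')|$ over pairs of distinct incident edges $e,e'$ (sharing an endpoint). The edge-bandwidth $B'(G)$ is the minimum of $B'(f)$ over all edge-numberings $f$ of $G$.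
   Formalization: With the maximum over no incident pairs taken as 0, the upper bound is stated only for G having two distinct incident edges (B'(G) ≥ 1) and sharpness only for k ≥ 1; for B'(G)=0 (e.g. a single edge) the upper bound 0 ≤ −1 fails and equality is impossible. *)

theory Defs
  imports Main
begin

text \<open>
  The endpoint set of a loop is a singleton, that of any other edge has two elements.
  Parallel edges are distinct edges with the same endpoint set.
\<close>

record ('v, 'e) multigraph =
  verts :: "'v set"
  edges :: "'e set"
  ends :: "'e \<Rightarrow> 'v set"

definition finite_multigraph :: "('v, 'e) multigraph \<Rightarrow> bool" where
  "finite_multigraph G \<longleftrightarrow>
     finite (verts G) \<and> finite (edges G) \<and>
     (\<forall>e\<in>edges G. ends G e \<subseteq> verts G \<and> card (ends G e) \<in> {1, 2})"

definition incident_edges :: "('v, 'e) multigraph \<Rightarrow> 'e \<Rightarrow> 'e \<Rightarrow> bool" where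
  "incident_edges G e e' \<longleftrightarrow>
     e \<in> edges G \<and> e' \<in> edges G \<and> e \<noteq> e' \<and> ends G e \<inter> ends G e' \<noteq> {}"

text \<open>
  The new vertex \<open>w\<close> only has to differ from the vertices that are kept, so \<open>w\<close> may reuse
  the name \<open>u\<close> or \<open>v\<close>. The case \<open>u = v\<close> is the contraction of a loop, which just deletes it.
  The map \<open>ends H\<close> is prescribed only on the edges of \<open>H\<close>.
\<close>

definition elementary_contraction ::
    "('v, 'e) multigraph \<Rightarrow> ('v, 'e) multigraph \<Rightarrow> bool" where
  "elementary_contraction G H \<longleftrightarrow>
     (\<exists>e\<in>edges G. \<exists>u v w.
        ends G e = {u, v} \<and> w \<notin> verts G - {u, v} \<and>
        verts H = insert w (verts G - {u, v}) \<and>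
        edges H = edges G - {e} \<and>
        (\<forall>e'\<in>edges H. ends H e' = (\<lambda>x. if x \<in> {u, v} then w else x) ` ends G e'))"

definition edge_numbering :: "('v, 'e) multigraph \<Rightarrow> ('e \<Rightarrow> int) \<Rightarrow> bool" where
  "edge_numbering G f \<longleftrightarrow> inj_on f (edges G)"

text \<open>
  If no two distinct edges are incident, the maximum over the empty set is taken to be \<open>0\<close>.
\<close>

definition numbering_bandwidth :: "('v, 'e) multigraph \<Rightarrow> ('e \<Rightarrow> int) \<Rightarrow> nat" where
  "numbering_bandwidth G f =
     Max (insert 0 {nat \<bar>f e - f e'\<bar> | e e'. incident_edges G e e'})"

definition edge_bandwidth :: "('v, 'e) multigraph \<Rightarrow> nat" where
  "edge_bandwidth G = (LEAST k. \<exists>f. edge_numbering G f \<and> numbering_bandwidth G f = k)"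

end

theory Submission
  imports Defs
begin

text \<open>
  Let \<open>e = uv\<close> be the contracted edge and \<open>w\<close> the new vertex.
  Given an optimal numbering of \<open>H\<close>, put \<open>e\<close> immediately before the smallest number at \<open>w\<close>
  and move everything from there on up by \<open>1\<close>: every difference grows by at most \<open>1\<close>.
  Given an optimal numbering \<open>f\<close> of \<open>G\<close> of bandwidth \<open>b\<close>, the edges at \<open>w\<close> have numbers in
  \<open>[f e - b, f e + b]\<close> other than \<open>f e\<close>; closing the gap at \<open>f e\<close> places them in an interval of
  length \<open>2 b - 1\<close>.
  Contracting one of \<open>k + 1\<close> parallel edges attains the lower bound, and contracting the central
  edge of the double star with \<open>k\<close> leaves on each side attains the upper bound, since
  \<open>m\<close> pairwise incident edges have edge-bandwidth \<open>m - 1\<close>.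
\<close>

section \<open>Bandwidth as an attained minimum\<close>

text \<open>Finitely many edges give finitely many differences, so \<open>Max\<close> is a true
  maximum; the inserted \<open>0\<close> puts no constraint on a natural bound.\<close>

lemma numbering_bandwidth_le_iff:
  assumes "finite (edges G)"
  shows "numbering_bandwidth G f \<le> k \<longleftrightarrow>
    (\<forall>e e'. incident_edges G e e' \<longrightarrow> \<bar>f e - f e'\<bar> \<le> int k)"
proof -
  let ?D = "{nat \<bar>f e - f e'\<bar> | e e'. incident_edges G e e'}"
  have "?D \<subseteq> (\<lambda>(e, e'). nat \<bar>f e - f e'\<bar>) ` (edges G \<times> edges G)"
    by (auto simp: incident_edges_def)
  then have "finite ?D"
    by (rule finite_subset) (use assms in simp)
  then have "numbering_bandwidth G f \<le> k \<longleftrightarrow>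
      (\<forall>e e'. incident_edges G e e' \<longrightarrow> nat \<bar>f e - f e'\<bar> \<le> k)"
    unfolding numbering_bandwidth_def by (subst Max_le_iff) blast+
  then show ?thesis
    by (simp only: nat_le_iff)
qed

lemma edge_bandwidth_le:
  assumes "finite (edges G)" "inj_on f (edges G)"
    and "\<And>e e'. incident_edges G e e' \<Longrightarrow> \<bar>f e - f e'\<bar> \<le> int k"
  shows "edge_bandwidth G \<le> k"
proof -
  have "edge_bandwidth G \<le> numbering_bandwidth G f"
    unfolding edge_bandwidth_def
    by (rule Least_le) (use assms in \<open>auto simp: edge_numbering_def\<close>)
  also have "\<dots> \<le> k"
    using assms by (simp add: numbering_bandwidth_le_iff)
  finally show ?thesis .
qed

text \<open>An enumeration of the finite edge set is an edge-numbering, so the \<open>LEAST\<close>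
  ranges over a nonempty set and is attained.\<close>

lemma optimal_edge_numbering:
  fixes G :: "('v, 'e) multigraph"
  assumes "finite (edges G)"
  obtains f where "inj_on f (edges G)"
    and "\<And>e e'. incident_edges G e e' \<Longrightarrow> \<bar>f e - f e'\<bar> \<le> int (edge_bandwidth G)"
proof -
  obtain g :: "'e \<Rightarrow> nat" where "inj_on g (edges G)"
    using finite_imp_inj_to_nat_seg[OF assms] by blast
  then have "edge_numbering G (int \<circ> g)"
    by (simp add: edge_numbering_def comp_inj_on)
  then have "\<exists>k f. edge_numbering G f \<and> numbering_bandwidth G f = k"
    by blast
  then have "\<exists>f. edge_numbering G f \<and> numbering_bandwidth G f = edge_bandwidth G"
    unfolding edge_bandwidth_def by (rule LeastI_ex)
  then obtain f where f: "edge_numbering G f" "numbering_bandwidth G f = edge_bandwidth G"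
    by blast
  then have "\<forall>e e'. incident_edges G e e' \<longrightarrow> \<bar>f e - f e'\<bar> \<le> int (edge_bandwidth G)"
    by (simp flip: numbering_bandwidth_le_iff[OF assms])
  with f(1) show ?thesis
    by (intro that[of f]) (simp_all add: edge_numbering_def)
qed

text \<open>All differences count here: \<open>m\<close> distinct integers spread over at least
  \<open>m - 1\<close>, and consecutive ones attain this. Without edges, truncated subtraction makes
  both sides \<open>0\<close>.\<close>

lemma edge_bandwidth_pairwise_incident:
  fixes G :: "('v, 'e) multigraph"
  assumes fin: "finite (edges G)"
    and inc: "\<And>e e'. e \<in> edges G \<Longrightarrow> e' \<in> edges G \<Longrightarrow> e \<noteq> e' \<Longrightarrow> incident_edges G e e'"
  shows "edge_bandwidth G = card (edges G) - 1"
proof (rule antisym)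
  obtain g :: "'e \<Rightarrow> nat" where g: "inj_on g (edges G)" "g ` edges G = {i. i < card (edges G)}"
    using ex_bij_betw_finite_nat[OF fin]
    by (auto simp: bij_betw_def atLeast0LessThan lessThan_def)
  show "edge_bandwidth G \<le> card (edges G) - 1"
  proof (rule edge_bandwidth_le[OF fin, of "int \<circ> g"])
    show "inj_on (int \<circ> g) (edges G)"
      using g(1) by (simp add: comp_inj_on)
    fix e e' assume "incident_edges G e e'"
    then have "g e < card (edges G)" "g e' < card (edges G)"
      using g(2) by (auto simp: incident_edges_def)
    then show "\<bar>(int \<circ> g) e - (int \<circ> g) e'\<bar> \<le> int (card (edges G) - 1)"
      by auto
  qed
  show "card (edges G) - 1 \<le> edge_bandwidth G"
  proof (cases "edges G = {}")
    case False
    obtain f where f: "inj_on f (edges G)"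
      "\<And>e e'. incident_edges G e e' \<Longrightarrow> \<bar>f e - f e'\<bar> \<le> int (edge_bandwidth G)"
      using optimal_edge_numbering[OF fin] by blast
    define m where "m = Min (f ` edges G)"
    have "m \<in> f ` edges G"
      unfolding m_def using fin False by simp
    then obtain a where a: "a \<in> edges G" "m = f a"
      by blast
    have "f ` edges G \<subseteq> {m..m + int (edge_bandwidth G)}"
    proof clarify
      fix x assume x: "x \<in> edges G"
      then have "m \<le> f x"
        unfolding m_def using fin by simp
      moreover have "\<bar>f x - f a\<bar> \<le> int (edge_bandwidth G)"
        using f(2) inc[OF x a(1)] by (cases "x = a") auto
      ultimately show "f x \<in> {m..m + int (edge_bandwidth G)}"
        using a(2) by auto
    qed
    then have "card (f ` edges G) \<le> card {m..m + int (edge_bandwidth G)}"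
      by (intro card_mono) auto
    then show ?thesis
      using card_image[OF f(1)] by simp
  qed simp
qed

section \<open>Incidence after a contraction\<close>

lemma incident_edges_contraction:
  assumes G: "finite_multigraph G" and a: "a \<in> edges G" "ends G a = {u, v}"
    and w: "w \<notin> verts G - {u, v}" and H: "edges H = edges G - {a}"
    and endsH: "\<forall>e'\<in>edges H. ends H e' = (\<lambda>x. if x \<in> {u, v} then w else x) ` ends G e'"
  shows "incident_edges H e e' \<longleftrightarrow> e \<noteq> a \<and> e' \<noteq> a \<and>
    (incident_edges G e e' \<or> e \<noteq> e' \<and> incident_edges G e a \<and> incident_edges G e' a)"
proof (cases "e \<in> edges G \<and> e' \<in> edges G \<and> e \<noteq> e' \<and> e \<noteq> a \<and> e' \<noteq> a")
  case True
  then have sub: "ends G e \<subseteq> verts G" "ends G e' \<subseteq> verts G"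
    using G by (auto simp: finite_multigraph_def)
  define r where "r x = (if x \<in> {u, v} then w else x)" for x
  \<comment> \<open>As \<open>w\<close> is not the name of a kept vertex, the renaming identifies
    \<open>u\<close> with \<open>v\<close> and nothing else.\<close>
  have r: "r x = r y \<longleftrightarrow> x = y \<or> x \<in> {u, v} \<and> y \<in> {u, v}"
    if "x \<in> verts G" "y \<in> verts G" for x y
    using that w by (auto simp: r_def)
  have "ends H e = r ` ends G e" "ends H e' = r ` ends G e'"
    using endsH H True by (auto simp: r_def)
  then have "ends H e \<inter> ends H e' \<noteq> {} \<longleftrightarrow> (\<exists>x\<in>ends G e. \<exists>y\<in>ends G e'. r x = r y)"
    by (auto simp: image_iff disjoint_iff)
  also have "\<dots> \<longleftrightarrow> (\<exists>x\<in>ends G e. \<exists>y\<in>ends G e'. x = y \<or> x \<in> {u, v} \<and> y \<in> {u, v})"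
    by (intro bex_cong refl r) (use sub in auto)
  also have "\<dots> \<longleftrightarrow> ends G e \<inter> ends G e' \<noteq> {} \<or>
      ends G e \<inter> {u, v} \<noteq> {} \<and> ends G e' \<inter> {u, v} \<noteq> {}"
    by blast
  finally have "ends H e \<inter> ends H e' \<noteq> {} \<longleftrightarrow> ends G e \<inter> ends G e' \<noteq> {} \<or>
      ends G e \<inter> {u, v} \<noteq> {} \<and> ends G e' \<inter> {u, v} \<noteq> {}" .
  then show ?thesis
    using True a H by (auto simp: incident_edges_def)
next
  case False
  then show ?thesis
    using H by (auto simp: incident_edges_def)
qed

text \<open>Bandwidth depends only on the edge set and incidence, so the vertices \<open>u\<close>,
  \<open>v\<close>, \<open>w\<close> can be forgotten from here on.\<close>

lemma elementary_contraction_incidence: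
  assumes "finite_multigraph G" "elementary_contraction G H"
  obtains a where "a \<in> edges G" "edges H = edges G - {a}"
    and "\<And>e e'. incident_edges H e e' \<longleftrightarrow> e \<noteq> a \<and> e' \<noteq> a \<and>
      (incident_edges G e e' \<or> e \<noteq> e' \<and> incident_edges G e a \<and> incident_edges G e' a)"
proof -
  from assms(2) obtain a u v w where *: "a \<in> edges G" "ends G a = {u, v}"
    "w \<notin> verts G - {u, v}" "edges H = edges G - {a}"
    "\<forall>e'\<in>edges H. ends H e' = (\<lambda>x. if x \<in> {u, v} then w else x) ` ends G e'"
    unfolding elementary_contraction_def by (elim bexE exE conjE) (rule that)
  show ?thesis
    by (rule that[OF *(1,4) incident_edges_contraction[OF assms(1) *]])
qed

section \<open>The two inequalities\<close>

lemma incident_edges_sym: "incident_edges G e e' \<longleftrightarrow> incident_edges G e' e"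
  by (auto simp: incident_edges_def)

lemma edge_bandwidth_le_contraction:
  assumes G: "finite_multigraph G" and "elementary_contraction G H"
  shows "edge_bandwidth G \<le> edge_bandwidth H + 1"
proof -
  obtain a where a: "a \<in> edges G" "edges H = edges G - {a}"
    and inc: "\<And>e e'. incident_edges H e e' \<longleftrightarrow> e \<noteq> a \<and> e' \<noteq> a \<and>
      (incident_edges G e e' \<or> e \<noteq> e' \<and> incident_edges G e a \<and> incident_edges G e' a)"
    using elementary_contraction_incidence[OF assms] by blast
  have finG: "finite (edges G)"
    using G by (simp add: finite_multigraph_def)
  then have finH: "finite (edges H)"
    using a by simp
  obtain f where f: "inj_on f (edges H)"
    "\<And>e e'. incident_edges H e e' \<Longrightarrow> \<bar>f e - f e'\<bar> \<le> int (edge_bandwidth H)"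
    using optimal_edge_numbering[OF finH] by blast
  define S where "S = {e. incident_edges G e a}"
  \<comment> \<open>If \<open>S\<close> is empty, \<open>m\<close> is an unspecified integer; any
    value serves then, since no edge is incident with \<open>a\<close>.\<close>
  define m where "m = Min (f ` S)"
  have finS: "finite S"
    by (rule finite_subset[OF _ finG]) (auto simp: S_def incident_edges_def)
  \<comment> \<open>The edges of \<open>S\<close> all pass through the new vertex of
    \<open>H\<close>, so they are pairwise incident there and lie in one window starting at
    \<open>m\<close>.\<close>
  have near_m: "m \<le> f e \<and> f e \<le> m + int (edge_bandwidth H)" if e: "e \<in> S" for e
  proof -
    have "m \<in> f ` S"
      unfolding m_def using finS e by (intro Min_in) auto
    then obtain s where s: "s \<in> S" "m = f s"
      by blast
    have "m \<le> f e"
      unfolding m_def using finS e by simp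
    moreover have "\<bar>f e - f s\<bar> \<le> int (edge_bandwidth H)"
    proof (cases "e = s")
      case False
      moreover have "e \<noteq> a" "s \<noteq> a"
        using e s(1) by (auto simp: S_def incident_edges_def)
      ultimately have "incident_edges H e s"
        using e s(1) by (simp add: inc S_def)
      then show ?thesis
        by (rule f(2))
    qed simp
    ultimately show ?thesis
      using s(2) by simp
  qed
  \<comment> \<open>The shift frees the number \<open>m\<close> for \<open>a\<close> and moves the
    window of \<open>S\<close> to start at \<open>m + 1\<close>, hence to end at distance at most
    \<open>edge_bandwidth H + 1\<close> from \<open>a\<close>.\<close>
  define g where "g e = (if e = a then m else if f e < m then f e else f e + 1)" for e
  show ?thesis
  proof (rule edge_bandwidth_le[OF finG, of g])
    show "inj_on g (edges G)"
      using f(1) a by (auto simp: inj_on_def g_def split: if_splits)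
    fix e e' assume ee: "incident_edges G e e'"
    then have "e \<noteq> e'"
      by (simp add: incident_edges_def)
    consider "e = a" "e' \<in> S" | "e' = a" "e \<in> S" | "e \<noteq> a" "e' \<noteq> a"
      using ee incident_edges_sym[of G e e'] by (auto simp: S_def)
    then show "\<bar>g e - g e'\<bar> \<le> int (edge_bandwidth H + 1)"
    proof cases
      case 3
      then have "\<bar>f e - f e'\<bar> \<le> int (edge_bandwidth H)"
        using ee inc f(2) by blast
      then show ?thesis
        using 3 by (auto simp: g_def)
    next
      case 1
      then show ?thesis
        using near_m[of e'] \<open>e \<noteq> e'\<close> by (simp add: g_def)
    next
      case 2
      then show ?thesis
        using near_m[of e] \<open>e \<noteq> e'\<close> by (simp add: g_def)
    qed
  qed
qed

lemma edge_bandwidth_pos: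
  assumes "finite (edges G)" "incident_edges G e e'"
  shows "edge_bandwidth G \<ge> 1"
proof -
  obtain f where f: "inj_on f (edges G)"
    "\<And>e e'. incident_edges G e e' \<Longrightarrow> \<bar>f e - f e'\<bar> \<le> int (edge_bandwidth G)"
    using optimal_edge_numbering[OF assms(1)] by blast
  have "f e \<noteq> f e'"
    using f(1) assms(2) by (auto simp: incident_edges_def inj_on_def)
  then show ?thesis
    using f(2)[OF assms(2)] by linarith
qed

lemma edge_bandwidth_contraction_le:
  assumes G: "finite_multigraph G" and "elementary_contraction G H"
    and pos: "edge_bandwidth G \<ge> 1"
  shows "edge_bandwidth H \<le> 2 * edge_bandwidth G - 1"
proof -
  obtain a where a: "a \<in> edges G" "edges H = edges G - {a}"
    and inc: "\<And>e e'. incident_edges H e e' \<longleftrightarrow> e \<noteq> a \<and> e' \<noteq> a \<and>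
      (incident_edges G e e' \<or> e \<noteq> e' \<and> incident_edges G e a \<and> incident_edges G e' a)"
    using elementary_contraction_incidence[OF assms(1,2)] by blast
  have finG: "finite (edges G)"
    using G by (simp add: finite_multigraph_def)
  then have finH: "finite (edges H)"
    using a by simp
  obtain f where f: "inj_on f (edges G)"
    "\<And>e e'. incident_edges G e e' \<Longrightarrow> \<bar>f e - f e'\<bar> \<le> int (edge_bandwidth G)"
    using optimal_edge_numbering[OF finG] by blast
  \<comment> \<open>No surviving edge has the number \<open>f a\<close>, so closing this gap keeps
    the numbers distinct.\<close>
  define g where "g e = (if f e < f a then f e else f e - 1)" for e
  have ne: "f e \<noteq> f a" if "e \<in> edges H" for e
    using that f(1) a by (auto simp: inj_on_def)
  show ?thesis
  proof (rule edge_bandwidth_le[OF finH, of g])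
    show "inj_on g (edges H)"
    proof (rule inj_onI)
      fix x y assume xy: "x \<in> edges H" "y \<in> edges H" "g x = g y"
      then have "f x = f y"
        using ne[OF xy(1)] ne[OF xy(2)] by (auto simp: g_def split: if_splits)
      then show "x = y"
        using xy f(1) a by (auto simp: inj_on_def)
    qed
    fix e e' assume ee: "incident_edges H e e'"
    then have ne': "f e \<noteq> f a" "f e' \<noteq> f a"
      using ne by (auto simp: incident_edges_def)
    have bound: "int (2 * edge_bandwidth G - 1) = 2 * int (edge_bandwidth G) - 1"
      using pos by simp
    from ee inc consider "incident_edges G e e'" | "incident_edges G e a" "incident_edges G e' a"
      by blast
    then show "\<bar>g e - g e'\<bar> \<le> int (2 * edge_bandwidth G - 1)"
    proof cases
      \<comment> \<open>Closing the gap increases no difference, and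
        \<open>b \<le> 2 * b - 1\<close> for \<open>b \<ge> 1\<close>.\<close>
      case 1
      then show ?thesis
        using f(2)[OF 1] ne' pos unfolding bound g_def by (auto split: if_splits)
    next
      \<comment> \<open>Both numbers are within \<open>b\<close> of \<open>f a\<close>. On opposite
        sides of it they differ by at most \<open>2 * b\<close>, and the closed gap saves
        \<open>1\<close>; on the same side they differ by less than \<open>b\<close>.\<close>
      case 2
      then show ?thesis
        using f(2)[OF 2(1)] f(2)[OF 2(2)] ne' pos unfolding bound g_def by (auto split: if_splits)
    qed
  qed
qed

section \<open>Extremal examples\<close>

lemma contraction_lower_bound_sharp:
  "\<exists>(G :: (nat, nat) multigraph) H. finite_multigraph G \<and> elementary_contraction G H \<and>
    edge_bandwidth G = k \<and> edge_bandwidth H = k - 1"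
proof -
  define G :: "(nat, nat) multigraph" where
    "G = \<lparr>verts = {0, 1}, edges = {..k}, ends = \<lambda>_. {0, 1}\<rparr>"
  define H :: "(nat, nat) multigraph" where
    "H = \<lparr>verts = {0}, edges = {..<k}, ends = \<lambda>_. {0}\<rparr>"
  have "finite_multigraph G"
    by (simp add: finite_multigraph_def G_def)
  moreover have "elementary_contraction G H"
    unfolding elementary_contraction_def
    \<comment> \<open>Edge \<open>k\<close> is contracted and the new vertex reuses the name
      \<open>0\<close>; the other \<open>k\<close> edges become loops there.\<close>
    by (rule bexI[of _ k], rule exI[of _ 0], rule exI[of _ 1], rule exI[of _ 0])
      (auto simp: G_def H_def)
  moreover have "edge_bandwidth G = card (edges G) - 1"
    by (rule edge_bandwidth_pairwise_incident) (auto simp: G_def incident_edges_def)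
  then have "edge_bandwidth G = k"
    by (simp add: G_def)
  moreover have "edge_bandwidth H = card (edges H) - 1"
    by (rule edge_bandwidth_pairwise_incident) (auto simp: H_def incident_edges_def)
  then have "edge_bandwidth H = k - 1"
    by (simp add: H_def)
  ultimately show ?thesis
    by blast
qed

lemma contraction_upper_bound_sharp:
  assumes k: "k \<ge> 1"
  shows "\<exists>(G :: (nat, nat) multigraph) H. finite_multigraph G \<and> elementary_contraction G H \<and>
    edge_bandwidth G = k \<and> edge_bandwidth H = 2 * k - 1"
proof -
  \<comment> \<open>The centres are \<open>0\<close> and \<open>1\<close>, and edge
    \<open>i \<noteq> k\<close> ends in the leaf \<open>i + 2\<close>, clear of both. Vertex
    \<open>k + 2\<close> is isolated.\<close>
  define G :: "(nat, nat) multigraph" where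
    "G = \<lparr>verts = {..2 * k + 2}, edges = {..2 * k},
      ends = \<lambda>i. if i = k then {0, 1} else if i < k then {0, i + 2} else {1, i + 2}\<rparr>"
  define H :: "(nat, nat) multigraph" where
    "H = \<lparr>verts = insert 0 ({..2 * k + 2} - {0, 1}), edges = {..2 * k} - {k},
      ends = \<lambda>i. {0, i + 2}\<rparr>"
  have G: "finite_multigraph G"
    using k by (auto simp: finite_multigraph_def G_def card_insert_if)
  have H: "elementary_contraction G H"
    unfolding elementary_contraction_def
    by (rule bexI[of _ k], rule exI[of _ 0], rule exI[of _ 1], rule exI[of _ 0])
      (auto simp: G_def H_def)
  have "edge_bandwidth H = card (edges H) - 1"
    by (rule edge_bandwidth_pairwise_incident) (auto simp: H_def incident_edges_def)
  then have bH: "edge_bandwidth H = 2 * k - 1"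
    by (simp add: H_def)
  \<comment> \<open>The edge names serve as numbers: \<open>0\<close> to \<open>k\<close> meet at
    vertex \<open>0\<close>, and \<open>k\<close> to \<open>2 * k\<close> at vertex
    \<open>1\<close>.\<close>
  have le: "edge_bandwidth G \<le> k"
    by (rule edge_bandwidth_le[of _ int])
      (auto simp: G_def incident_edges_def split: if_splits)
  \<comment> \<open>The bound \<open>k \<le> edge_bandwidth G\<close> comes from the upper
    inequality itself, as \<open>H\<close> already has edge-bandwidth
    \<open>2 * k - 1\<close>.\<close>
  have "incident_edges G 0 k"
    using k by (auto simp: G_def incident_edges_def)
  then have "edge_bandwidth G \<ge> 1"
    by (rule edge_bandwidth_pos[rotated]) (simp add: G_def)
  then have "edge_bandwidth H \<le> 2 * edge_bandwidth G - 1"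
    by (rule edge_bandwidth_contraction_le[OF G H])
  with le bH k have "edge_bandwidth G = k"
    by linarith
  with G H bH show ?thesis
    by blast
qed

text \<open>Integer casts avoid truncated subtraction. Without incident edges
  \<open>edge_bandwidth G\<close> is \<open>0\<close> and the upper bound would be
  \<open>-1\<close>; for the same reason neither equality can hold at \<open>k = 0\<close>.\<close>

theorem theorem12:
  "(\<forall>(G :: ('v, 'e) multigraph) H.
      finite_multigraph G \<and> elementary_contraction G H \<longrightarrow>
        int (edge_bandwidth G) - 1 \<le> int (edge_bandwidth H) \<and>
        ((\<exists>e e'. incident_edges G e e') \<longrightarrow>
           int (edge_bandwidth H) \<le> 2 * int (edge_bandwidth G) - 1)) \<and>
   (\<forall>k::nat. k \<ge> 1 \<longrightarrow>
      (\<exists>(G :: (nat, nat) multigraph) H.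
         finite_multigraph G \<and> elementary_contraction G H \<and> edge_bandwidth G = k \<and>
         int (edge_bandwidth H) = int (edge_bandwidth G) - 1) \<and>
      (\<exists>(G :: (nat, nat) multigraph) H.
         finite_multigraph G \<and> elementary_contraction G H \<and> edge_bandwidth G = k \<and>
         int (edge_bandwidth H) = 2 * int (edge_bandwidth G) - 1))"
proof (intro conjI allI impI; (elim conjE exE)?)
  fix G H :: "('v, 'e) multigraph"
  assume GH: "finite_multigraph G" "elementary_contraction G H"
  show "int (edge_bandwidth G) - 1 \<le> int (edge_bandwidth H)"
    using edge_bandwidth_le_contraction[OF GH] by linarith
  fix e e' assume "incident_edges G e e'"
  then have pos: "edge_bandwidth G \<ge> 1"
    using GH(1) by (intro edge_bandwidth_pos) (auto simp: finite_multigraph_def)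
  show "int (edge_bandwidth H) \<le> 2 * int (edge_bandwidth G) - 1"
    using edge_bandwidth_contraction_le[OF GH pos] pos by linarith
next
  fix k :: nat assume k: "k \<ge> 1"
  show "\<exists>(G :: (nat, nat) multigraph) H.
      finite_multigraph G \<and> elementary_contraction G H \<and> edge_bandwidth G = k \<and>
      int (edge_bandwidth H) = int (edge_bandwidth G) - 1"
  proof -
    obtain G H :: "(nat, nat) multigraph" where "finite_multigraph G" "elementary_contraction G H"
      "edge_bandwidth G = k" "edge_bandwidth H = k - 1"
      using contraction_lower_bound_sharp by blast
    with k show ?thesis
      by (intro exI[of _ G] exI[of _ H]) simp
  qed
  show "\<exists>(G :: (nat, nat) multigraph) H.
      finite_multigraph G \<and> elementary_contraction G H \<and> edge_bandwidth G = k \<and>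
      int (edge_bandwidth H) = 2 * int (edge_bandwidth G) - 1"
  proof -
    obtain G H :: "(nat, nat) multigraph" where "finite_multigraph G" "elementary_contraction G H"
      "edge_bandwidth G = k" "edge_bandwidth H = 2 * k - 1"
      using contraction_upper_bound_sharp[OF k] by blast
    with k show ?thesis
      by (intro exI[of _ G] exI[of _ H]) simp
  qed
qed

end
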